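(* Let $F$ be a real vector space, let $\lambda_1,\ldots,\lambda_m \in F^*$ be linear functionals, and let $\Lambda: F \to \mathbb{R}^m$, $\Lambda(f) = (\lambda_1(f),\ldots,\lambda_m(f))$. Suppose that the model set $\mathcal{K} \subseteq F$ is convex and contains the origin and that the functional $\gamma: F \to \mathbb{R}$ is sup-linear, i.e., of the form $$\gamma(f) = \sup_{i \in I} \gamma_i(f), \qquad f \in F,$$ where the $\gamma_i \in F^*$, $i \in I$, are linear functionals (the index set $I$ need not be finite). Then there exists an optimal estimation functional $\delta^{\rm opti}: \mathbb{R}^m \to \mathbb{R}$ for $\gamma$ which is sup-affine with the same index set $I$, i.e., there are scalars $c^{(i)}_0, c^{(i)}_1,\ldots,c^{(i)}_m \in \mathbb{R}$, $i \in I$, such that $$\delta^{\rm opti}(y) = \sup_{i \in I}\bigg( c^{(i)}_0 + \sum_{k=1}^m c^{(i)}_k y_k \bigg), \qquad y \in \mathbb{R}^m.$$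
   Context: $F^*$ denotes the space of linear functionals on $F$. The worst-case error over $\mathcal{K}$ of an estimation functional $\delta: \mathbb{R}^m \to \mathbb{R}$ for $\gamma$ is $$e(\delta) := \sup_{f \in \mathcal{K}} |\gamma(f) - \delta(\Lambda(f))| \in [0,+\infty].$$ For every $\delta: \mathbb{R}^m \to \mathbb{R}$ one has the lower bound $e(\delta) \ge e_\flat$, where $$e_\flat := \sup_{\substack{f',f'' \in \mathcal{K}\\ \Lambda(f')=\Lambda(f'')}} \frac{|\gamma(f')-\gamma(f'')|}{2} \in [0,+\infty].$$ An estimation functional $\delta$ is called (genuinely) optimal if $e(\delta) \le e_\flat$, so that $e(\delta) = e_\flat$ is the minimal value of the error over all functionals from $\mathbb{R}^m$ to $\mathbb{R}$. *)

theory Defs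
  imports "HOL-Analysis.Analysis"
begin

definition observation_map :: "('m::finite \<Rightarrow> 'f \<Rightarrow> real) \<Rightarrow> 'f \<Rightarrow> real ^ 'm" where
  "observation_map lam f = (\<chi> k. lam k f)"

definition worst_case_error ::
  "'f set \<Rightarrow> ('f \<Rightarrow> 'y) \<Rightarrow> ('f \<Rightarrow> real) \<Rightarrow> ('y \<Rightarrow> real) \<Rightarrow> ennreal" where
  "worst_case_error K Lam \<gamma> \<delta> = (SUP f\<in>K. ennreal \<bar>\<gamma> f - \<delta> (Lam f)\<bar>)"

definition error_lower_bound ::
  "'f set \<Rightarrow> ('f \<Rightarrow> 'y) \<Rightarrow> ('f \<Rightarrow> real) \<Rightarrow> ennreal" where
  "error_lower_bound K Lam \<gamma> =
     (SUP (f', f'') \<in> {(f', f''). f' \<in> K \<and> f'' \<in> K \<and> Lam f' = Lam f''}.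
        ennreal (\<bar>\<gamma> f' - \<gamma> f''\<bar> / 2))"

definition optimal_estimation ::
  "'f set \<Rightarrow> ('f \<Rightarrow> 'y) \<Rightarrow> ('f \<Rightarrow> real) \<Rightarrow> ('y \<Rightarrow> real) \<Rightarrow> bool" where
  "optimal_estimation K Lam \<gamma> \<delta> \<longleftrightarrow>
     worst_case_error K Lam \<gamma> \<delta> \<le> error_lower_bound K Lam \<gamma>"

text \<open>The suprema below are taken in the extended reals: equating them with a real number
  says that the supremum is genuinely finite. The supremum operator on the type of real numbers
  would instead return an unspecified value for an empty or unbounded family. In particular a
  sup-linear or sup-affine function necessarily has a nonempty index set.\<close>

definition sup_linear :: "'i set \<Rightarrow> ('i \<Rightarrow> 'f::real_vector \<Rightarrow> real) \<Rightarrow> ('f \<Rightarrow> real) \<Rightarrow> bool" where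
  "sup_linear I g \<gamma> \<longleftrightarrow>
     (\<forall>i\<in>I. linear (g i)) \<and> (\<forall>f. ereal (\<gamma> f) = (SUP i\<in>I. ereal (g i f)))"

definition sup_affine :: "'i set \<Rightarrow> (real ^ 'm::finite \<Rightarrow> real) \<Rightarrow> bool" where
  "sup_affine I \<delta> \<longleftrightarrow>
     (\<exists>(c0 :: 'i \<Rightarrow> real) (c :: 'i \<Rightarrow> 'm \<Rightarrow> real).
        \<forall>y. ereal (\<delta> y) = (SUP i\<in>I. ereal (c0 i + (\<Sum>k\<in>UNIV. c i k * y $ k))))"

lemma error_lower_bound_le_worst_case_error:
  "error_lower_bound K Lam \<gamma> \<le> worst_case_error K Lam \<gamma> \<delta>"
  unfolding error_lower_bound_def
proof (rule SUP_least, clarify)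
  fix f' f'' assume f: "f' \<in> K" "f'' \<in> K" "Lam f' = Lam f''"
  have upper: "ennreal \<bar>\<gamma> f - \<delta> (Lam f)\<bar> \<le> worst_case_error K Lam \<gamma> \<delta>" if "f \<in> K" for f
    unfolding worst_case_error_def using that by (rule SUP_upper)
  have "\<bar>\<gamma> f' - \<gamma> f''\<bar> / 2 \<le> max \<bar>\<gamma> f' - \<delta> (Lam f')\<bar> \<bar>\<gamma> f'' - \<delta> (Lam f'')\<bar>"
    using f(3) by (auto simp: max_def abs_if split: if_splits)
  then have "ennreal (\<bar>\<gamma> f' - \<gamma> f''\<bar> / 2)
      \<le> ennreal (max \<bar>\<gamma> f' - \<delta> (Lam f')\<bar> \<bar>\<gamma> f'' - \<delta> (Lam f'')\<bar>)"
    by (rule ennreal_leI)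
  also have "\<dots> \<le> worst_case_error K Lam \<gamma> \<delta>"
    using upper[OF f(1)] upper[OF f(2)] by (simp add: max_def)
  finally show "ennreal (\<bar>\<gamma> f' - \<gamma> f''\<bar> / 2) \<le> worst_case_error K Lam \<gamma> \<delta>" .
qed

end

theory Submission
  imports Defs
begin

text \<open>
  Write \<open>L\<close> for the observation map and \<open>E\<close> for the lower bound on the error. If \<open>E\<close> is
  infinite, every functional is optimal. Otherwise each \<open>g i\<close> is treated separately. On \<open>K\<close>, the
  linear function \<open>g i - E\<close> lies below the convex function \<open>\<gamma> + E\<close>, and it does so even when the
  two are evaluated at different points with the same observation: from \<open>g i \<le> \<gamma>\<close> the difference
  \<open>g i f - \<gamma> f'\<close> is at most \<open>\<gamma> f - \<gamma> f'\<close>, hence at most \<open>2 * E\<close>. So a hyperplane in the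
  finite-dimensional space of pairs (observation, value) separates the two functions, which yields
  an affine function \<open>y \<mapsto> b i + c i \<bullet> y\<close> whose composition with \<open>L\<close> lies between them
  (\<open>affine_sandwich_along_linear_map\<close>). With \<open>\<delta>\<close> the supremum of these affine functions, the
  lower halves of the sandwiches give \<open>\<gamma> \<le> \<delta> \<circ> L + E\<close> on \<open>K\<close> and the upper halves give
  \<open>\<delta> \<circ> L \<le> \<gamma> + E\<close>, so \<open>\<delta>\<close> is optimal.

  What remains is that this supremum is finite at every \<open>y\<close>, although the upper bound \<open>\<gamma> + E\<close>
  speaks only of observations of points of \<open>K\<close>. Evaluation at the origin gives \<open>\<bar>b i\<bar> \<le> E\<close>. As
  \<open>\<gamma>\<close> is finite on the whole space, \<open>g i f = - g i (- f) \<ge> - \<gamma> (- f)\<close>: the family \<open>g\<close> is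
  bounded below at each point, uniformly in \<open>i\<close>. Hence \<open>c i \<bullet> y\<close> is bounded in \<open>i\<close> on both sides
  for each \<open>y\<close> in \<open>L ` K\<close>. Since the slopes \<open>c i\<close> can be chosen in the span of \<open>L ` K\<close>, this
  carries over to all \<open>y\<close> (\<open>bounded_inner_everywhere\<close>).
\<close>

section \<open>Separation by an affine function of the observation\<close>

text \<open>
  The concave function \<open>y \<mapsto> sup p\<close> over the fibre \<open>L f = y\<close> lies below the convex function
  \<open>y \<mapsto> inf q\<close> over the same fibre, so the hypograph of one and the strict epigraph of the other
  can be separated; the set \<open>S\<close> in the proof is their difference. The separating
  hyperplane must not be vertical, that is, its normal must have a nonzero component along the
  value axis. A normal chosen in the span of \<open>S\<close> guarantees this: the normal of a vertical
  hyperplane would be orthogonal to all of \<open>S\<close>, hence to itself. The same choice places the slope \<open>c\<close> in the span of \<open>L ` K\<close>.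
\<close>

lemma affine_sandwich_along_linear_map:
  fixes L :: "'f::real_vector \<Rightarrow> 'v::euclidean_space"
  assumes L: "linear L" and p: "concave_on K p" and q: "convex_on K q" and ne: "K \<noteq> {}"
    and le: "\<And>f f'. f \<in> K \<Longrightarrow> f' \<in> K \<Longrightarrow> L f = L f' \<Longrightarrow> p f \<le> q f'"
  obtains b c where "c \<in> span (L ` K)"
    and "\<And>f. f \<in> K \<Longrightarrow> p f \<le> b + c \<bullet> L f"
    and "\<And>f. f \<in> K \<Longrightarrow> b + c \<bullet> L f \<le> q f"
proof -
  define S where "S = {(L f' - L f, r) | f f' r. f \<in> K \<and> f' \<in> K \<and> q f' - p f < r}"
  have S_I: "(L f' - L f, r) \<in> S" if "f \<in> K" "f' \<in> K" "q f' - p f < r" for f f' r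
    using that unfolding S_def by blast
  have K: "convex K" using q by (rule convex_on_imp_convex)
  have "convex S"
  proof (rule convexI)
    fix x y and u v :: real
    assume "x \<in> S" "y \<in> S" and uv: "0 \<le> u" "0 \<le> v" "u + v = 1"
    then obtain f f' r h h' s
      where x: "x = (L f' - L f, r)" "f \<in> K" "f' \<in> K" "q f' - p f < r"
        and y: "y = (L h' - L h, s)" "h \<in> K" "h' \<in> K" "q h' - p h < s"
      unfolding S_def by blast
    define k k' where "k = u *\<^sub>R f + v *\<^sub>R h" and "k' = u *\<^sub>R f' + v *\<^sub>R h'"
    have kK: "k \<in> K" "k' \<in> K"
      using K x y uv unfolding k_def k'_def by (auto intro: convexD)
    have "q k' \<le> u * q f' + v * q h'"
      using q x y uv unfolding k'_def convex_on_def by blast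
    moreover have "u * p f + v * p h \<le> p k"
      using p x y uv unfolding k_def concave_on_iff by blast
    moreover have "u * (q f' - p f) + v * (q h' - p h) < u * r + v * s"
    proof (cases "u = 0")
      case True
      then show ?thesis using uv y by simp
    next
      case False
      then have "u * (q f' - p f) < u * r" using uv x by simp
      moreover have "v * (q h' - p h) \<le> v * s" using uv y by (intro mult_left_mono) auto
      ultimately show ?thesis by linarith
    qed
    ultimately have "q k' - p k < u * r + v * s" by (simp add: algebra_simps)
    then have "(L k' - L k, u * r + v * s) \<in> S" using kK by (intro S_I)
    moreover have "u *\<^sub>R x + v *\<^sub>R y = (L k' - L k, u * r + v * s)"
      unfolding x y k_def k'_def
      by (simp add: linear_add[OF L] linear_scale[OF L] algebra_simps)
    ultimately show "u *\<^sub>R x + v *\<^sub>R y \<in> S" by simp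
  qed
  moreover obtain f0 where f0: "f0 \<in> K" using ne by blast
  then have "S \<noteq> {}" using S_I[of f0 f0 "q f0 - p f0 + 1"] by auto
  moreover have "0 \<notin> S"
    using le unfolding S_def zero_prod_def by force
  ultimately obtain a where a: "a \<in> span S" "a \<noteq> 0" "\<And>x. x \<in> S \<Longrightarrow> 0 \<le> a \<bullet> x"
    using separating_hyperplane_set_0_inspan[of S] by blast
  obtain u s where us: "a = (u, s)" by (cases a)
  have sep: "0 \<le> u \<bullet> (L f' - L f) + s * r" if "f \<in> K" "f' \<in> K" "q f' - p f < r" for f f' r
    using a(3)[OF S_I[OF that]] by (simp add: us)
  have "span S \<subseteq> span (L ` K) \<times> UNIV"
  proof (rule span_minimal)
    have "L f \<in> span (L ` K)" if "f \<in> K" for f using that by (intro span_base imageI)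
    then show "S \<subseteq> span (L ` K) \<times> UNIV"
      unfolding S_def using span_diff by blast
    show "subspace (span (L ` K) \<times> (UNIV :: real set))"
      by (intro subspace_Times subspace_span subspace_UNIV)
  qed
  then have u: "u \<in> span (L ` K)" using a(1) us by auto
  \<comment> \<open>With both points equal to \<open>f0\<close>, the first component of a member of \<open>S\<close> vanishes.\<close>
  have "0 \<le> s"
  proof (rule ccontr)
    assume "\<not> 0 \<le> s"
    define d where "d = \<bar>q f0 - p f0\<bar> + 1"
    have "q f0 - p f0 < d" "0 < d" unfolding d_def by auto
    with sep[OF f0 f0, of d] \<open>\<not> 0 \<le> s\<close> show False
      by (simp add: zero_le_mult_iff)
  qed
  moreover have "s \<noteq> 0"
  proof
    assume "s = 0"
    \<comment> \<open>Exchanging the two points turns the inequality into equality.\<close>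
    have le': "u \<bullet> L f \<le> u \<bullet> L f'" if "f \<in> K" "f' \<in> K" for f f'
      using sep[OF that, of "q f' - p f + 1"] \<open>s = 0\<close> by (simp add: inner_diff_right)
    have eq: "u \<bullet> L f' = u \<bullet> L f" if "f \<in> K" "f' \<in> K" for f f'
      using le'[OF that] le'[OF that(2,1)] by simp
    have "orthogonal a x" if x: "x \<in> S" for x
    proof -
      obtain f f' r where "x = (L f' - L f, r)" "f \<in> K" "f' \<in> K"
        using x unfolding S_def by blast
      then show ?thesis
        using eq[of f f'] \<open>s = 0\<close> by (simp add: us orthogonal_def inner_diff_right)
    qed
    then have "orthogonal a a"
      using a(1) orthogonal_to_span by blast
    then show False using a(2) by (simp add: orthogonal_def)
  qed
  ultimately have s: "0 < s" by simp
  define c where "c = - (1 / s) *\<^sub>R u"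
  have gap: "p f - c \<bullet> L f \<le> q f' - c \<bullet> L f'" if "f \<in> K" "f' \<in> K" for f f'
  proof (rule field_le_epsilon)
    fix e :: real assume "0 < e"
    then have "0 \<le> u \<bullet> (L f' - L f) + s * (q f' - p f + e)" using that by (intro sep) auto
    then have "0 \<le> (u \<bullet> (L f' - L f) + s * (q f' - p f + e)) / s" using s by simp
    also have "\<dots> = q f' - c \<bullet> L f' + e - (p f - c \<bullet> L f)"
      using s unfolding c_def by (simp add: field_simps inner_diff_right)
    finally show "p f - c \<bullet> L f \<le> q f' - c \<bullet> L f' + e" by simp
  qed
  \<comment> \<open>The intercept may be any number between the two sides of \<open>gap\<close>.\<close>
  define b where "b = (SUP f\<in>K. p f - c \<bullet> L f)"
  show thesis
  proof
    show "c \<in> span (L ` K)" unfolding c_def using u by (rule span_mul)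
    show "p f \<le> b + c \<bullet> L f" if "f \<in> K" for f
    proof -
      have "p f - c \<bullet> L f \<le> b"
        unfolding b_def using gap f0 that by (intro cSUP_upper) (auto simp: bdd_above_def)
      then show ?thesis by simp
    qed
    show "b + c \<bullet> L f \<le> q f" if "f \<in> K" for f
    proof -
      have "b \<le> q f - c \<bullet> L f" unfolding b_def using ne gap that by (intro cSUP_least)
      then show ?thesis by simp
    qed
  qed
qed

text \<open>
  The points at which the family is bounded form a subspace that contains \<open>C\<close>, and on the
  orthogonal complement of the span of \<open>C\<close> every \<open>c i\<close> vanishes.
\<close>

lemma bounded_inner_everywhere:
  fixes c :: "'i \<Rightarrow> 'v::euclidean_space"
  assumes c: "\<And>i. i \<in> I \<Longrightarrow> c i \<in> span C"
    and bd: "\<And>y. y \<in> C \<Longrightarrow> bounded ((\<lambda>i. c i \<bullet> y) ` I)"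
  shows "bounded ((\<lambda>i. c i \<bullet> y) ` I)"
proof -
  have sub: "subspace {y. bounded ((\<lambda>i. c i \<bullet> y) ` I)}"
  proof (rule subspaceI; unfold mem_Collect_eq)
    show "bounded ((\<lambda>i. c i \<bullet> 0) ` I)"
      by (auto simp: bounded_iff)
    fix x assume x: "bounded ((\<lambda>i. c i \<bullet> x) ` I)"
    show "bounded ((\<lambda>i. c i \<bullet> (x + y)) ` I)" if "bounded ((\<lambda>i. c i \<bullet> y) ` I)" for y
      unfolding inner_add_right using x that by (rule bounded_plus_comp)
    show "bounded ((\<lambda>i. c i \<bullet> (r *\<^sub>R x)) ` I)" for r
      using bounded_scaleR_comp[OF x, of r] by simp
  qed
  obtain v w where "y = v + w" "v \<in> span C" and w: "\<And>x. x \<in> span C \<Longrightarrow> orthogonal w x"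
    using orthogonal_subspace_decomp_exists[of C y] by metis
  have "(\<lambda>i. c i \<bullet> y) ` I = (\<lambda>i. c i \<bullet> v) ` I"
  proof (rule image_cong[OF refl])
    fix i assume "i \<in> I"
    then have "c i \<bullet> w = 0" using w[OF c] by (simp add: orthogonal_def inner_commute)
    then show "c i \<bullet> y = c i \<bullet> v" by (simp add: \<open>y = v + w\<close> inner_add_right)
  qed
  moreover have "span C \<subseteq> {y. bounded ((\<lambda>i. c i \<bullet> y) ` I)}"
    using bd sub by (intro span_minimal) auto
  ultimately show ?thesis using \<open>v \<in> span C\<close> by auto
qed

section \<open>Sup-linear and sup-affine functions\<close>

lemma sup_linear_upper:
  assumes "sup_linear I g \<gamma>" "i \<in> I"
  shows "g i f \<le> \<gamma> f"
proof -
  have "ereal (g i f) \<le> (SUP i\<in>I. ereal (g i f))" using assms(2) by (rule SUP_upper)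
  then show ?thesis using assms(1) by (simp add: sup_linear_def flip: ereal_less_eq(3))
qed

lemma sup_linear_least:
  assumes "sup_linear I g \<gamma>" "\<And>i. i \<in> I \<Longrightarrow> g i f \<le> M"
  shows "\<gamma> f \<le> M"
proof -
  have "(SUP i\<in>I. ereal (g i f)) \<le> ereal M" using assms(2) by (intro SUP_least) simp
  then show ?thesis using assms(1) by (simp add: sup_linear_def flip: ereal_less_eq(3))
qed

text \<open>Over an empty index set every number would be an upper bound for the value.\<close>

lemma sup_linear_nonempty:
  assumes "sup_linear I g \<gamma>"
  shows "I \<noteq> {}"
  using sup_linear_least[OF assms, of 0 "\<gamma> 0 - 1"] by auto

lemma sup_linear_linear:
  "sup_linear I g \<gamma> \<Longrightarrow> i \<in> I \<Longrightarrow> linear (g i)"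
  by (simp add: sup_linear_def)

lemma sup_linear_zero:
  assumes "sup_linear I g \<gamma>"
  shows "\<gamma> 0 = 0"
proof (rule antisym)
  show "\<gamma> 0 \<le> 0"
    using sup_linear_linear[OF assms] by (intro sup_linear_least[OF assms]) (simp add: linear_0)
  obtain i where i: "i \<in> I" using sup_linear_nonempty[OF assms] by blast
  show "0 \<le> \<gamma> 0"
    using sup_linear_upper[OF assms i, of 0] linear_0[OF sup_linear_linear[OF assms i]] by simp
qed

lemma sup_linear_convex_on:
  assumes "sup_linear I g \<gamma>" and "convex K"
  shows "convex_on K \<gamma>"
  unfolding convex_on_def
proof (intro conjI ballI allI impI assms(2))
  fix x y and u v :: real assume uv: "0 \<le> u" "0 \<le> v"
  show "\<gamma> (u *\<^sub>R x + v *\<^sub>R y) \<le> u * \<gamma> x + v * \<gamma> y"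
  proof (rule sup_linear_least[OF assms(1)])
    fix i assume i: "i \<in> I"
    note lin = sup_linear_linear[OF assms(1) i]
    show "g i (u *\<^sub>R x + v *\<^sub>R y) \<le> u * \<gamma> x + v * \<gamma> y"
      unfolding linear_add[OF lin] linear_scale[OF lin] real_scaleR_def
      using uv sup_linear_upper[OF assms(1) i] by (intro add_mono mult_left_mono)
  qed
qed

text \<open>Pointwise boundedness makes the real supremum agree with the extended real one.\<close>

lemma sup_affineI:
  fixes c :: "'i \<Rightarrow> real ^ 'm::finite"
  assumes "I \<noteq> {}" and "\<And>y. bdd_above ((\<lambda>i. b i + c i \<bullet> y) ` I)"
  shows "sup_affine I (\<lambda>y. SUP i\<in>I. b i + c i \<bullet> y)"
  unfolding sup_affine_def
proof (intro exI allI)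
  fix y :: "real ^ 'm"
  have "ereal (SUP i\<in>I. b i + c i \<bullet> y) = (SUP i\<in>I. ereal (b i + c i \<bullet> y))"
  proof (rule antisym)
    obtain M where M: "\<And>i. i \<in> I \<Longrightarrow> b i + c i \<bullet> y \<le> M"
      using assms(2)[of y] by (auto simp: bdd_above_def)
    obtain j where j: "j \<in> I" using assms(1) by blast
    have "(SUP i\<in>I. ereal (b i + c i \<bullet> y)) \<le> ereal M" using M by (intro SUP_least) simp
    moreover have "ereal (b j + c j \<bullet> y) \<le> (SUP i\<in>I. ereal (b i + c i \<bullet> y))"
      using j by (rule SUP_upper)
    ultimately have "\<bar>SUP i\<in>I. ereal (b i + c i \<bullet> y)\<bar> \<noteq> \<infinity>" by auto
    then show "ereal (SUP i\<in>I. b i + c i \<bullet> y) \<le> (SUP i\<in>I. ereal (b i + c i \<bullet> y))"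
      by (simp add: ereal_SUP)
    show "(SUP i\<in>I. ereal (b i + c i \<bullet> y)) \<le> ereal (SUP i\<in>I. b i + c i \<bullet> y)"
      using assms(2) by (intro SUP_least) (auto intro: cSUP_upper)
  qed
  then show "ereal (SUP i\<in>I. b i + c i \<bullet> y)
      = (SUP i\<in>I. ereal (b i + (\<Sum>k\<in>UNIV. c i $ k * y $ k)))"
    by (simp add: inner_vec_def)
qed

section \<open>Existence of an optimal sup-affine functional\<close>

theorem theorem1:
  fixes lam :: "'m::finite \<Rightarrow> 'f::real_vector \<Rightarrow> real"
    and K :: "'f set"
    and I :: "'i set"
    and g :: "'i \<Rightarrow> 'f \<Rightarrow> real"
    and \<gamma> :: "'f \<Rightarrow> real"
  assumes "\<And>k. linear (lam k)"
    and "convex K"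
    and "0 \<in> K"
    and "sup_linear I g \<gamma>"
  shows "\<exists>\<delta> :: real ^ 'm \<Rightarrow> real.
           optimal_estimation K (observation_map lam) \<gamma> \<delta> \<and> sup_affine I \<delta>"
proof (cases "error_lower_bound K (observation_map lam) \<gamma> = \<infinity>")
  case True
  have "sup_affine I (\<lambda>y :: real ^ 'm. SUP i\<in>I. 0 + 0 \<bullet> y)"
    using sup_linear_nonempty[OF assms(4)] by (intro sup_affineI) (auto simp: bdd_above_def)
  moreover have "optimal_estimation K (observation_map lam) \<gamma> \<delta>" for \<delta>
    using True by (simp add: optimal_estimation_def)
  ultimately show ?thesis by blast
next
  case False
  define L where "L = observation_map lam"
  define E where "E = enn2real (error_lower_bound K L \<gamma>)"
  have E: "error_lower_bound K L \<gamma> = ennreal E"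
    using False unfolding E_def L_def by (simp add: less_top)
  have "0 \<le> E" unfolding E_def by simp
  have L: "linear L"
    unfolding L_def observation_map_def
    by (rule linearI)
       (simp_all add: vec_eq_iff linear_add[OF assms(1)] linear_scale[OF assms(1)])
  note upper = sup_linear_upper[OF assms(4)]
  note lin = sup_linear_linear[OF assms(4)]
  have spread: "\<gamma> f - \<gamma> f' \<le> 2 * E" if "f \<in> K" "f' \<in> K" "L f = L f'" for f f'
  proof -
    have "ennreal (\<bar>\<gamma> f - \<gamma> f'\<bar> / 2) \<le> error_lower_bound K L \<gamma>"
      unfolding error_lower_bound_def using that
      by (intro SUP_upper2[where i="(f, f')"]) auto
    then show ?thesis using \<open>0 \<le> E\<close> by (simp add: E)
  qed
  have "\<exists>b c. c \<in> span (L ` K) \<and>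
      (\<forall>f\<in>K. g i f - E \<le> b + c \<bullet> L f \<and> b + c \<bullet> L f \<le> \<gamma> f + E)" if i: "i \<in> I" for i
  proof (rule affine_sandwich_along_linear_map[OF L])
    show "concave_on K (\<lambda>f. g i f - E)"
      unfolding concave_on_iff
    proof (intro conjI ballI allI impI assms(2))
      fix x y and u v :: real assume uv: "u + v = 1"
      have "u * E + v * E = E" using uv by (simp flip: distrib_right)
      then show "u * (g i x - E) + v * (g i y - E) \<le> g i (u *\<^sub>R x + v *\<^sub>R y) - E"
        by (simp add: linear_add[OF lin[OF i]] linear_scale[OF lin[OF i]] right_diff_distrib)
    qed
    show "convex_on K (\<lambda>f. \<gamma> f + E)"
      using sup_linear_convex_on[OF assms(4,2)] assms(2) by (intro convex_on_add) (simp_all add: convex_on_const)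
    show "K \<noteq> {}" using assms(3) by blast
    show "g i f - E \<le> \<gamma> f' + E" if "f \<in> K" "f' \<in> K" "L f = L f'" for f f'
      using upper[OF i, of f] spread[OF that] by simp
  qed blast
  then obtain b c where c: "\<And>i. i \<in> I \<Longrightarrow> c i \<in> span (L ` K)"
    and lo: "\<And>i f. i \<in> I \<Longrightarrow> f \<in> K \<Longrightarrow> g i f - E \<le> b i + c i \<bullet> L f"
    and hi: "\<And>i f. i \<in> I \<Longrightarrow> f \<in> K \<Longrightarrow> b i + c i \<bullet> L f \<le> \<gamma> f + E"
    by metis
  \<comment> \<open>At the origin the sandwich reads \<open>- E \<le> b i \<le> E\<close>.\<close>
  have b: "\<bar>b i\<bar> \<le> E" if "i \<in> I" for i
    using lo[OF that assms(3)] hi[OF that assms(3)] sup_linear_zero[OF assms(4)]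
      linear_0[OF lin[OF that]] linear_0[OF L] by simp
  have "bounded ((\<lambda>i. c i \<bullet> y) ` I)" if y: "y \<in> L ` K" for y
  proof -
    obtain f where f: "f \<in> K" "y = L f" using y by blast
    \<comment> \<open>The lower bound on \<open>c i \<bullet> y\<close> comes from \<open>g i f = - g i (- f) \<ge> - \<gamma> (- f)\<close>.\<close>
    have "\<bar>c i \<bullet> y\<bar> \<le> \<bar>\<gamma> f\<bar> + \<bar>\<gamma> (- f)\<bar> + 2 * E" if "i \<in> I" for i
      using lo[OF that f(1)] hi[OF that f(1)] b[OF that] upper[OF that, of "- f"]
        linear_neg[OF lin[OF that], of f] unfolding f(2) by linarith
    then show ?thesis unfolding bounded_iff by auto
  qed
  with c have bd: "bounded ((\<lambda>i. c i \<bullet> y) ` I)" for y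
    by (rule bounded_inner_everywhere)
  have bdd: "bdd_above ((\<lambda>i. b i + c i \<bullet> y) ` I)" for y
  proof -
    have "bounded (b ` I)" using b unfolding bounded_iff by auto
    then show ?thesis using bd by (intro bounded_imp_bdd_above bounded_plus_comp)
  qed
  define \<delta> where "\<delta> = (\<lambda>y. SUP i\<in>I. b i + c i \<bullet> y)"
  have "\<bar>\<gamma> f - \<delta> (L f)\<bar> \<le> E" if f: "f \<in> K" for f
  proof -
    have "\<delta> (L f) \<le> \<gamma> f + E"
      unfolding \<delta>_def using sup_linear_nonempty[OF assms(4)] hi f by (intro cSUP_least)
    moreover have "\<gamma> f \<le> \<delta> (L f) + E"
    proof (rule sup_linear_least[OF assms(4)])
      fix i assume i: "i \<in> I"
      have "b i + c i \<bullet> L f \<le> \<delta> (L f)" unfolding \<delta>_def using i bdd by (rule cSUP_upper)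
      then show "g i f \<le> \<delta> (L f) + E" using lo[OF i f] by simp
    qed
    ultimately show ?thesis by linarith
  qed
  then have "optimal_estimation K L \<gamma> \<delta>"
    unfolding optimal_estimation_def worst_case_error_def E by (intro SUP_least ennreal_leI)
  moreover have "sup_affine I \<delta>"
    unfolding \<delta>_def using sup_linear_nonempty[OF assms(4)] bdd by (rule sup_affineI)
  ultimately show ?thesis unfolding L_def by blast
qed

end
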